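(* Let $\mathcal{K}$ and $\varpi$ be as in the context, let $d,n\in\mathbb{N}$, and let $\boldsymbol{f}=(f_1,\dots,f_d)^\top\in\mathcal{L}^2_\varpi(\mathcal{K};\mathbb{R}^d)$ satisfy $$\int_{\mathcal{K}}\varpi(\tau)\boldsymbol{f}(\tau)\boldsymbol{f}^\top(\tau)\,d\tau\succ 0 .$$ Define $\mathsf{F}:=\left(\int_{\mathcal{K}}\varpi(\tau)\boldsymbol{f}(\tau)\boldsymbol{f}^\top(\tau)\,d\tau\right)^{-1}\in\mathbb{R}^{d\times d}$, $F(\tau):=\boldsymbol{f}(\tau)\otimes I_n\in\mathbb{R}^{dn\times n}$, and, for $\boldsymbol{x}\in\mathcal{L}^2_\varpi(\mathcal{K};\mathbb{R}^n)$, $\boldsymbol{\vartheta}:=\int_{\mathcal{K}}\varpi(\tau)F(\tau)\boldsymbol{x}(\tau)\,d\tau\in\mathbb{R}^{dn}$. Then for all $\boldsymbol{x}\in\mathcal{L}^2_\varpi(\mathcal{K};\mathbb{R}^n)$ and all symmetric positive definite $U\in\mathbb{R}^{n\times n}$, $$\int_{\mathcal{K}}\varpi(\tau)\boldsymbol{x}^\top(\tau)U\boldsymbol{x}(\tau)\,d\tau\ \ge\ \boldsymbol{\vartheta}^\top(\mathsf{F}\otimes U)\boldsymbol{\vartheta}.$$ Moreover, this lower bound is optimal in the following sense: for every $\boldsymbol{\omega}\in\mathbb{R}^{dn}$, $$2\boldsymbol{\vartheta}^\top(I_d\otimes U)\boldsymbol{\omega}-\boldsymbol{\omega}^\top(\mathsf{F}^{-1}\otimes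 U)\boldsymbol{\omega}\ \le\ \boldsymbol{\vartheta}^\top(\mathsf{F}\otimes U)\boldsymbol{\vartheta},$$ with equality for $\boldsymbol{\omega}=(\mathsf{F}\otimes I_n)\boldsymbol{\vartheta}$.
   Context: $\mathcal{K}\subseteq\mathbb{R}\cup\{\pm\infty\}$ is a Lebesgue measurable set with $\int_{\mathcal{K}}d\tau\neq 0$. The weight $\varpi:\mathcal{K}\to\mathbb{R}_{\ge 0}$ is measurable and has only finitely or countably infinitely many zeros. For $m\in\mathbb{N}$, $\mathcal{L}^2_\varpi(\mathcal{K};\mathbb{R}^m)$ is the set of measurable functions $\boldsymbol{\phi}:\mathcal{K}\to\mathbb{R}^m$ with $\|\boldsymbol{\phi}\|_{2,\varpi}^2:=\int_{\mathcal{K}}\varpi(\tau)\boldsymbol{\phi}^\top(\tau)\boldsymbol{\phi}(\tau)\,d\tau<\infty$. $\otimes$ is the Kronecker product, $I_n$ the $n\times n$ identity matrix, and $\succ 0$ means symmetric positive definite. *)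

theory Defs
  imports "HOL-Analysis.Analysis"
begin

(* Lebesgue measure on the extended reals: a set is measurable iff its real part is Lebesgue
   measurable, and the two infinite points form a null set. *)
definition lebesgue_ereal :: "ereal measure" where
  "lebesgue_ereal = distr lebesgue (sigma UNIV {A. ereal -` A \<in> sets lebesgue}) ereal"

lemma space_lebesgue_ereal [simp]: "space lebesgue_ereal = UNIV"
  by (simp add: lebesgue_ereal_def)

lemma sets_lebesgue_ereal: "A \<in> sets lebesgue_ereal \<longleftrightarrow> ereal -` A \<in> sets lebesgue"
proof -
  have "sigma_algebra UNIV {A. ereal -` A \<in> sets lebesgue}"
    unfolding sigma_algebra_iff2
    by (auto simp: vimage_Diff vimage_UN intro: sets.compl_sets[of _ lebesgue, simplified])
  then show ?thesis
    by (simp add: lebesgue_ereal_def sigma_algebra.sigma_sets_eq)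
qed

lemma emeasure_lebesgue_ereal:
  assumes "A \<in> sets lebesgue_ereal"
  shows "emeasure lebesgue_ereal A = emeasure lebesgue (ereal -` A)"
proof -
  have "ereal \<in> measurable lebesgue (sigma UNIV {A. ereal -` A \<in> sets lebesgue})"
    by (rule measurable_sigma_sets[where \<Omega> = UNIV and A = "{A. ereal -` A \<in> sets lebesgue}"]) auto
  moreover have "A \<in> sets (sigma UNIV {A. ereal -` A \<in> sets lebesgue})"
    using assms by (simp add: lebesgue_ereal_def)
  ultimately show ?thesis
    by (simp add: lebesgue_ereal_def emeasure_distr)
qed

(* Functions are total in HOL; only their values on K matter. *)
definition weighted_L2 :: "ereal set \<Rightarrow> (ereal \<Rightarrow> real) \<Rightarrow> (ereal \<Rightarrow> real^'m) set" where
  "weighted_L2 K w =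
     {\<phi> \<in> borel_measurable (restrict_space lebesgue_ereal K).
        (\<integral>\<^sup>+\<tau>\<in>K. ennreal (w \<tau> * (\<phi> \<tau> \<bullet> \<phi> \<tau>)) \<partial>lebesgue_ereal) < \<infinity>}"

definition pos_def_matrix :: "real^'n^'n \<Rightarrow> bool" where
  "pos_def_matrix A \<longleftrightarrow> transpose A = A \<and> (\<forall>v. v \<noteq> 0 \<longrightarrow> v \<bullet> (A *v v) > 0)"

(* The matrix v v^T.  The type annotation is needed: rowvector and columnvector are polymorphic
   in the index type of the second dimension. *)
definition outer :: "real^'d \<Rightarrow> real^'d^'d" where
  "outer v = (columnvector v :: real^1^'d) ** rowvector v"

lemma outer_nth: "outer v $ i $ j = v $ i * v $ j"
  by (simp add: outer_def columnvector_def rowvector_def matrix_matrix_mult_def)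

(* The product index (i, k) plays the role of the index (i - 1) n + k of the block ordering. *)
definition kron :: "real^'b^'a \<Rightarrow> real^'d^'c \<Rightarrow> real^('b \<times> 'd)^('a \<times> 'c)" where
  "kron A B = (\<chi> p q. A $ fst p $ fst q * B $ snd p $ snd q)"

(* Kronecker product of a column vector with a matrix; the column index (1, l) is identified
   with l, see kron_columnvector. *)
definition kron_vec :: "real^'a \<Rightarrow> real^'d^'c \<Rightarrow> real^'d^('a \<times> 'c)" where
  "kron_vec v B = (\<chi> p l. v $ fst p * B $ snd p $ l)"

lemma kron_columnvector: "kron (columnvector v :: real^1^'a) B $ p $ (1, l) = kron_vec v B $ p $ l"
  by (simp add: kron_def kron_vec_def columnvector_def)

end

theory Submission
  imports Defs
begin

text \<open>
  For a fixed vector \<open>\<omega>\<close> the function \<open>y \<tau> = (f \<tau> \<otimes> I)\<^sup>T \<omega>\<close> is a combination of the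
  components of \<open>f\<close> with vector coefficients, and the residual \<open>x - y\<close> has nonnegative weighted
  energy with respect to \<open>U\<close>.  Expanding that energy gives, for every \<open>\<omega>\<close>,
  \<open>\<integral> w x\<^sup>T U x \<ge> 2 \<theta>\<^sup>T (I \<otimes> U) \<omega> - \<omega>\<^sup>T (G \<otimes> U) \<omega>\<close>  (\<open>weighted_energy_ge\<close>):
  the data of \<open>x\<close> enter the cross term only through its moments \<open>\<theta>\<close>, and the square term only
  contains the Gram matrix \<open>G\<close> of \<open>f\<close>.

  The right-hand side is a concave quadratic in \<open>\<omega>\<close>.  Since
  \<open>(G \<otimes> U) (G\<^sup>-\<^sup>1 \<otimes> I) = I \<otimes> U\<close>, completing the square (\<open>complete_square\<close>) shows that it lies
  below \<open>\<theta>\<^sup>T (G\<^sup>-\<^sup>1 \<otimes> U) \<theta>\<close> by exactly the value of the quadratic form of \<open>G \<otimes> U\<close> at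
  \<open>\<omega> - (G\<^sup>-\<^sup>1 \<otimes> I) \<theta>\<close>.  So \<open>\<omega> = (G\<^sup>-\<^sup>1 \<otimes> I) \<theta>\<close> attains the maximum, which is both the
  asserted lower bound and its optimality.  That \<open>G \<otimes> U\<close> is positive semidefinite is the case
  \<open>x = 0\<close> of the same energy inequality: \<open>\<omega>\<^sup>T (G \<otimes> U) \<omega>\<close> is the energy of \<open>y\<close>.
\<close>

section \<open>Kronecker products and inverses of real matrices\<close>

lemma sum_prod_UNIV:
  fixes g :: "'a::finite \<times> 'b::finite \<Rightarrow> real"
  shows "(\<Sum>p\<in>UNIV. g p) = (\<Sum>i\<in>UNIV. \<Sum>j\<in>UNIV. g (i, j))"
  by (simp add: sum.cartesian_product)

lemma kron_mult_kron: "kron A B ** kron C D = kron (A ** C) (B ** D)"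
  by (simp add: vec_eq_iff kron_def matrix_matrix_mult_def sum_prod_UNIV sum_product ac_simps)

lemma kron_mult_kron_vec: "kron A B ** kron_vec v C = kron_vec (A *v v) (B ** C)"
  by (simp add: vec_eq_iff kron_def kron_vec_def matrix_matrix_mult_def matrix_vector_mult_def
      sum_prod_UNIV sum_product ac_simps)

lemma kron_vec_mult: "kron_vec v A ** B = kron_vec v (A ** B)"
  by (simp add: vec_eq_iff kron_vec_def matrix_matrix_mult_def sum_distrib_left ac_simps)

lemma kron_vec_mult_transpose:
  "kron_vec v A ** transpose (kron_vec v B) = kron (outer v) (A ** transpose B)"
  by (simp add: vec_eq_iff kron_vec_def kron_def transpose_def outer_nth matrix_matrix_mult_def
      sum_distrib_left ac_simps)

lemma transpose_kron: "transpose (kron A B) = kron (transpose A) (transpose B)"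
  by (simp add: vec_eq_iff kron_def transpose_def)

lemma inner_mult_transpose:
  fixes A :: "real^'n^'m"
  shows "u \<bullet> (A *v v) = (transpose A *v u) \<bullet> v"
  by (simp add: dot_lmul_matrix)

lemma invertible_pos_def_matrix:
  fixes A :: "real^'n^'n"
  assumes "pos_def_matrix A"
  shows "invertible A"
proof -
  have "A *v v = 0 \<Longrightarrow> v = 0" for v
    using assms unfolding pos_def_matrix_def by (metis inner_zero_right less_irrefl)
  then show ?thesis
    by (metis invertible_left_inverse matrix_left_invertible_ker)
qed

lemma matrix_inv_inverse:
  fixes A :: "real^'n^'n"
  assumes "invertible A"
  shows "A ** matrix_inv A = mat 1" "matrix_inv A ** A = mat 1"
  using someI_ex[OF assms[unfolded invertible_def]] by (simp_all add: matrix_inv_def)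

lemma matrix_inv_matrix_inv:
  fixes A :: "real^'n^'n"
  assumes "invertible A"
  shows "matrix_inv (matrix_inv A) = A"
proof -
  have "invertible (matrix_inv A)"
    using matrix_inv_inverse[OF assms] unfolding invertible_def by blast
  then show ?thesis
    using matrix_inv_inverse(1)[OF assms] matrix_inv_inverse(1)
    by (metis matrix_mul_assoc matrix_mul_lid matrix_mul_rid)
qed

section \<open>Quadratic forms\<close>

text \<open>
  If \<open>P\<close> is positive definite, then \<open>R Q = R P\<^sup>-\<^sup>1 R\<close> and this is the usual maximisation of
  \<open>2 t\<^sup>T R z - z\<^sup>T P z\<close> over \<open>z\<close>.  The factor \<open>Q\<close> replaces \<open>P\<^sup>-\<^sup>1 R\<close>, so that no inverse of
  the Kronecker product \<open>P = G \<otimes> U\<close> has to be formed.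
\<close>

lemma complete_square:
  fixes P Q R :: "real^'m^'m"
  assumes "transpose P = P" and "transpose R = R" and "P ** Q = R"
  shows "t \<bullet> ((R ** Q) *v t) - (2 * (t \<bullet> (R *v z)) - z \<bullet> (P *v z)) =
         (z - Q *v t) \<bullet> (P *v (z - Q *v t))"
proof -
  have 1: "P *v (Q *v t) = R *v t"
    using assms(3) by (simp add: matrix_vector_mul_assoc)
  have 2: "(Q *v t) \<bullet> (P *v z) = t \<bullet> (R *v z)"
    using 1 by (metis assms(1,2) inner_commute inner_mult_transpose)
  have 3: "(Q *v t) \<bullet> (R *v t) = t \<bullet> ((R ** Q) *v t)"
    by (metis assms(2) inner_commute inner_mult_transpose matrix_vector_mul_assoc)
  have 4: "z \<bullet> (R *v t) = t \<bullet> (R *v z)"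
    by (metis assms(2) inner_commute inner_mult_transpose)
  show ?thesis
    by (simp add: matrix_vector_mult_diff_distrib inner_diff_left inner_diff_right 1 2 3 4)
qed

text \<open>
  The pointwise identity to be integrated.  With \<open>F = v \<otimes> I\<close>, the mixed product rule moves \<open>U\<close>
  out of the cross term, \<open>F U = (I \<otimes> U) F\<close>, and collapses the square term,
  \<open>F U F\<^sup>T = (v v\<^sup>T) \<otimes> U\<close>, so that \<open>F x\<close> and \<open>v v\<^sup>T\<close> both enter linearly.
\<close>

lemma residual_quadratic_form:
  fixes U :: "real^'n^'n" and v :: "real^'d" and \<omega> :: "real^('d \<times> 'n)"
  assumes "transpose U = U"
  defines "Fv \<equiv> kron_vec v (mat 1) :: real^'n^('d \<times> 'n)"
  shows "(x - transpose Fv *v \<omega>) \<bullet> (U *v (x - transpose Fv *v \<omega>)) =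
     x \<bullet> (U *v x) - 2 * ((Fv *v x) \<bullet> (kron (mat 1 :: real^'d^'d) U *v \<omega>))
       + \<omega> \<bullet> (kron (outer v) U *v \<omega>)"
proof -
  let ?y = "transpose Fv *v \<omega>"
  have "?y \<bullet> (U *v x) = \<omega> \<bullet> ((Fv ** U) *v x)"
    by (simp only: inner_mult_transpose[of \<omega> Fv, symmetric] flip: matrix_vector_mul_assoc)
  also have "Fv ** U = kron (mat 1 :: real^'d^'d) U ** Fv"
    by (simp add: Fv_def kron_vec_mult kron_mult_kron_vec)
  also have "\<omega> \<bullet> (kron (mat 1 :: real^'d^'d) U ** Fv *v x) = (Fv *v x) \<bullet> (kron (mat 1 :: real^'d^'d) U *v \<omega>)"
    using assms(1) inner_mult_transpose[of \<omega> "kron (mat 1 :: real^'d^'d) U" "Fv *v x"]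
    by (simp add: matrix_vector_mul_assoc transpose_kron inner_commute)
  finally have cross: "?y \<bullet> (U *v x) = (Fv *v x) \<bullet> (kron (mat 1 :: real^'d^'d) U *v \<omega>)" .
  have "?y \<bullet> (U *v ?y) = \<omega> \<bullet> ((Fv ** U ** transpose Fv) *v \<omega>)"
    by (simp only: inner_mult_transpose[of \<omega> Fv, symmetric] flip: matrix_vector_mul_assoc)
  also have "Fv ** U ** transpose Fv = kron (outer v) U"
    by (simp only: Fv_def kron_vec_mult[of v "mat 1" U] matrix_mul_lid kron_vec_mult_transpose
        transpose_mat matrix_mul_rid)
  finally have square: "?y \<bullet> (U *v ?y) = \<omega> \<bullet> (kron (outer v) U *v \<omega>)" .
  have "x \<bullet> (U *v ?y) = ?y \<bullet> (U *v x)"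
    by (metis assms(1) inner_commute inner_mult_transpose)
  with cross square show ?thesis
    by (simp add: matrix_vector_mult_diff_distrib inner_diff_left inner_diff_right)
qed

section \<open>The weighted energy inequality\<close>

text \<open>
  Integrability of \<open>x\<^sup>T U x\<close>, of \<open>F x\<close> and of \<open>f f\<^sup>T\<close> has one common reason: all three are bilinear
  in square integrable functions, and \<open>\<parallel>a\<parallel> \<parallel>b\<parallel> \<le> \<parallel>a\<parallel>\<^sup>2 + \<parallel>b\<parallel>\<^sup>2\<close>.
\<close>

lemma integrable_weighted_bilinear:
  fixes h :: "'a::euclidean_space \<Rightarrow> 'b::euclidean_space \<Rightarrow> 'c::euclidean_space"
  assumes h: "bounded_bilinear h"
    and [measurable]: "w \<in> borel_measurable N" "f \<in> borel_measurable N" "g \<in> borel_measurable N"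
    and w: "\<And>\<tau>. \<tau> \<in> space N \<Longrightarrow> 0 \<le> w \<tau>"
    and f: "integrable N (\<lambda>\<tau>. w \<tau> * (f \<tau> \<bullet> f \<tau>))"
    and g: "integrable N (\<lambda>\<tau>. w \<tau> * (g \<tau> \<bullet> g \<tau>))"
  shows "integrable N (\<lambda>\<tau>. w \<tau> *\<^sub>R h (f \<tau>) (g \<tau>))"
proof -
  interpret bounded_bilinear h by (fact h)
  obtain C where C: "0 < C" "\<And>a b. norm (h a b) \<le> norm a * norm b * C"
    using pos_bounded by blast
  have [measurable]: "(\<lambda>\<tau>. h (f \<tau>) (g \<tau>)) \<in> borel_measurable N"
    by (rule borel_measurable_continuous_Pair)
       (auto intro!: continuous_on continuous_intros)
  show ?thesis
  proof (rule Bochner_Integration.integrable_bound)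
    show "integrable N (\<lambda>\<tau>. C * (w \<tau> * (f \<tau> \<bullet> f \<tau>) + w \<tau> * (g \<tau> \<bullet> g \<tau>)))"
      using f g by simp
    show "AE \<tau> in N. norm (w \<tau> *\<^sub>R h (f \<tau>) (g \<tau>)) \<le>
        norm (C * (w \<tau> * (f \<tau> \<bullet> f \<tau>) + w \<tau> * (g \<tau> \<bullet> g \<tau>)))"
    proof (rule AE_I2)
      fix \<tau> assume "\<tau> \<in> space N"
      then have w0: "0 \<le> w \<tau>" by (rule w)
      have "norm (f \<tau>) * norm (g \<tau>) \<le> (norm (f \<tau>))\<^sup>2 + (norm (g \<tau>))\<^sup>2"
        using sum_squares_bound[of "norm (f \<tau>)" "norm (g \<tau>)"]
          mult_nonneg_nonneg[OF norm_ge_zero[of "f \<tau>"] norm_ge_zero[of "g \<tau>"]]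
        by linarith
      then have "norm (h (f \<tau>) (g \<tau>)) \<le> ((norm (f \<tau>))\<^sup>2 + (norm (g \<tau>))\<^sup>2) * C"
        using C(1) C(2)[of "f \<tau>" "g \<tau>"] by (meson mult_right_mono less_imp_le order_trans)
      then have "w \<tau> * norm (h (f \<tau>) (g \<tau>)) \<le> w \<tau> * (((norm (f \<tau>))\<^sup>2 + (norm (g \<tau>))\<^sup>2) * C)"
        using w0 by (rule mult_left_mono)
      also have "\<dots> \<le> \<bar>C * (w \<tau> * (f \<tau> \<bullet> f \<tau>) + w \<tau> * (g \<tau> \<bullet> g \<tau>))\<bar>"
        by (simp add: power2_norm_eq_inner algebra_simps)
      finally show "norm (w \<tau> *\<^sub>R h (f \<tau>) (g \<tau>)) \<le>
        norm (C * (w \<tau> * (f \<tau> \<bullet> f \<tau>) + w \<tau> * (g \<tau> \<bullet> g \<tau>)))"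
        using w0 by simp
    qed
  qed simp
qed

text \<open>
  The energy of the residual \<open>x - (f \<otimes> I)\<^sup>T \<omega>\<close> is nonnegative, and its integral splits because
  each of the three terms of \<open>residual_quadratic_form\<close> is integrable and, for fixed \<open>\<omega>\<close>, the last
  two are linear in \<open>F x\<close> and in \<open>f f\<^sup>T\<close>.
\<close>

lemma weighted_energy_ge:
  fixes f :: "'a \<Rightarrow> real^'d" and x :: "'a \<Rightarrow> real^'n" and U :: "real^'n^'n"
    and \<omega> :: "real^('d \<times> 'n)"
  assumes meas: "w \<in> borel_measurable N" "f \<in> borel_measurable N" "x \<in> borel_measurable N"
    and w: "\<And>\<tau>. \<tau> \<in> space N \<Longrightarrow> 0 \<le> w \<tau>"
    and f: "integrable N (\<lambda>\<tau>. w \<tau> * (f \<tau> \<bullet> f \<tau>))"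
    and x: "integrable N (\<lambda>\<tau>. w \<tau> * (x \<tau> \<bullet> x \<tau>))"
    and U: "pos_def_matrix U"
  defines "G \<equiv> LINT \<tau>|N. w \<tau> *\<^sub>R outer (f \<tau>)"
    and "\<theta> \<equiv> LINT \<tau>|N. w \<tau> *\<^sub>R ((kron_vec (f \<tau>) (mat 1) :: real^'n^('d \<times> 'n)) *v x \<tau>)"
  shows "2 * (\<theta> \<bullet> (kron (mat 1 :: real^'d^'d) U *v \<omega>)) - \<omega> \<bullet> (kron G U *v \<omega>)
     \<le> (LINT \<tau>|N. w \<tau> * (x \<tau> \<bullet> (U *v x \<tau>)))"
proof -
  define F where "F = (\<lambda>\<tau>. kron_vec (f \<tau>) (mat 1) :: real^'n^('d \<times> 'n))"
  define quad where "quad = (\<lambda>A :: real^'d^'d. \<omega> \<bullet> (kron A U *v \<omega>))"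
  let ?r = "kron (mat 1 :: real^'d^'d) U *v \<omega>"
  have symU: "transpose U = U" and nonnegU: "0 \<le> v \<bullet> (U *v v)" for v
    using U by (cases "v = 0"; force simp: pos_def_matrix_def)+
  have quad: "bounded_linear quad"
    unfolding quad_def linear_conv_bounded_linear[symmetric]
    by (rule linearI)
      (simp_all add: inner_vec_def matrix_vector_mult_def kron_def sum_distrib_left 
        algebra_simps sum.distrib)
  have quad_scale: "quad (c *\<^sub>R A) = c * quad A" for c A
    using linear_scale[OF bounded_linear.linear[OF quad]] by simp
  have int_U: "integrable N (\<lambda>\<tau>. w \<tau> * (x \<tau> \<bullet> (U *v x \<tau>)))"
  proof -
    have "bilinear (\<lambda>a b. a \<bullet> (U *v b))"
      by (auto simp: bilinear_def intro!: linearI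
          simp: inner_add_left matrix_vector_right_distrib inner_add_right matrix_vector_mult_scaleR)
    then have "bounded_bilinear (\<lambda>a b. a \<bullet> (U *v b))"
      by (simp add: bilinear_conv_bounded_bilinear)
    from integrable_weighted_bilinear[OF this meas(1,3,3) w x x] show ?thesis
      by simp
  qed
  have int_F: "integrable N (\<lambda>\<tau>. w \<tau> *\<^sub>R (F \<tau> *v x \<tau>))"
  proof -
    have "bilinear (\<lambda>(a::real^'d) (b::real^'n). (kron_vec a (mat 1) :: real^'n^('d \<times> 'n)) *v b)"
      by (auto simp: bilinear_def vec_eq_iff kron_vec_def matrix_vector_mult_def algebra_simps 
          sum.distrib sum_distrib_left intro!: linearI)
    then show ?thesis
      unfolding F_def using integrable_weighted_bilinear[OF _ meas w f x]
      by (simp add: bilinear_conv_bounded_bilinear)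
  qed
  have int_outer: "integrable N (\<lambda>\<tau>. w \<tau> *\<^sub>R outer (f \<tau>))"
  proof -
    have "bilinear (\<lambda>(a::real^'d) (b::real^'d). (\<chi> i j. a $ i * b $ j) :: real^'d^'d)"
      by (auto simp: bilinear_def vec_eq_iff algebra_simps intro!: linearI)
    moreover have "outer v = (\<chi> i j. v $ i * v $ j)" for v :: "real^'d"
      by (simp add: vec_eq_iff outer_nth)
    ultimately show ?thesis
      using integrable_weighted_bilinear[OF _ meas(1,2,2) w f f]
      by (simp add: bilinear_conv_bounded_bilinear)
  qed
  have int_quad: "integrable N (\<lambda>\<tau>. quad (w \<tau> *\<^sub>R outer (f \<tau>)))"
    using integrable_bounded_linear[OF quad int_outer] .
  have int_cross: "integrable N (\<lambda>\<tau>. (w \<tau> *\<^sub>R (F \<tau> *v x \<tau>)) \<bullet> ?r)"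
    using int_F by (rule integrable_inner_left)
  have "0 \<le> (LINT \<tau>|N. w \<tau> * ((x \<tau> - transpose (F \<tau>) *v \<omega>) \<bullet> (U *v (x \<tau> - transpose (F \<tau>) *v \<omega>))))"
    using w nonnegU by (intro integral_nonneg_AE AE_I2) simp
  also have "\<dots> = (LINT \<tau>|N. w \<tau> * (x \<tau> \<bullet> (U *v x \<tau>))
      - 2 * ((w \<tau> *\<^sub>R (F \<tau> *v x \<tau>)) \<bullet> ?r) + quad (w \<tau> *\<^sub>R outer (f \<tau>)))"
    by (simp only: F_def residual_quadratic_form[OF symU] quad_scale)
      (simp add: quad_def algebra_simps)
  also have "\<dots> = (LINT \<tau>|N. w \<tau> * (x \<tau> \<bullet> (U *v x \<tau>)))
      - 2 * (LINT \<tau>|N. (w \<tau> *\<^sub>R (F \<tau> *v x \<tau>)) \<bullet> ?r) + (LINT \<tau>|N. quad (w \<tau> *\<^sub>R outer (f \<tau>)))"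
    using int_U int_cross int_quad by simp
  also have "(LINT \<tau>|N. (w \<tau> *\<^sub>R (F \<tau> *v x \<tau>)) \<bullet> ?r) = \<theta> \<bullet> ?r"
    unfolding \<theta>_def F_def[THEN fun_cong, symmetric]
    using int_F by (rule integral_inner_left)
  also have "(LINT \<tau>|N. quad (w \<tau> *\<^sub>R outer (f \<tau>))) = quad G"
    unfolding G_def by (rule integral_bounded_linear[OF quad int_outer])
  finally show ?thesis
    by (simp add: quad_def)
qed

section \<open>The optimal lower bound\<close>

lemma set_lebesgue_integral_restrict_space:
  fixes g :: "'a \<Rightarrow> 'b::{banach, second_countable_topology}"
  assumes "K \<in> sets M"
  shows "(LINT \<tau>:K|M. g \<tau>) = (LINT \<tau>|restrict_space M K. g \<tau>)"
  using assms by (simp add: set_lebesgue_integral_def integral_restrict_space)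

lemma weighted_L2_integrable:
  assumes K: "K \<in> sets lebesgue_ereal"
    and w: "w \<in> borel_measurable (restrict_space lebesgue_ereal K)" "\<forall>\<tau>\<in>K. 0 \<le> w \<tau>"
    and f: "f \<in> weighted_L2 K w"
  shows "integrable (restrict_space lebesgue_ereal K) (\<lambda>\<tau>. w \<tau> * (f \<tau> \<bullet> f \<tau>))"
proof (rule integrableI_nonneg)
  show "(\<lambda>\<tau>. w \<tau> * (f \<tau> \<bullet> f \<tau>)) \<in> borel_measurable (restrict_space lebesgue_ereal K)"
    using w(1) f
    by (intro borel_measurable_times borel_measurable_inner) (simp_all add: weighted_L2_def)
  show "AE \<tau> in restrict_space lebesgue_ereal K. 0 \<le> w \<tau> * (f \<tau> \<bullet> f \<tau>)"
    using w by (intro AE_I2) (simp add: space_restrict_space)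
  show "(\<integral>\<^sup>+ \<tau>. ennreal (w \<tau> * (f \<tau> \<bullet> f \<tau>)) \<partial>restrict_space lebesgue_ereal K) < \<infinity>"
    using f K by (simp add: weighted_L2_def nn_integral_restrict_space)
qed

theorem theorem1:
  fixes K :: "ereal set" and w :: "ereal \<Rightarrow> real"
    and f :: "ereal \<Rightarrow> real^'d" and x :: "ereal \<Rightarrow> real^'n"
    and U :: "real^'n^'n"
    and G :: "real^'d^'d" and FF :: "real^'d^'d"
    and F :: "ereal \<Rightarrow> real^'n^('d \<times> 'n)" and \<theta> :: "real^('d \<times> 'n)"
  defines "G \<equiv> (LINT \<tau>:K|lebesgue_ereal. w \<tau> *\<^sub>R outer (f \<tau>))"
  defines "FF \<equiv> matrix_inv G"
  defines "F \<equiv> (\<lambda>\<tau>. kron_vec (f \<tau>) (mat 1))"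
  defines "\<theta> \<equiv> (LINT \<tau>:K|lebesgue_ereal. w \<tau> *\<^sub>R (F \<tau> *v x \<tau>))"
  assumes "K \<in> sets lebesgue_ereal" and "emeasure lebesgue_ereal K \<noteq> 0"
    and "w \<in> borel_measurable (restrict_space lebesgue_ereal K)"
    and "\<forall>\<tau>\<in>K. w \<tau> \<ge> 0" and "countable {\<tau>\<in>K. w \<tau> = 0}"
    and "f \<in> weighted_L2 K w" and "pos_def_matrix G"
    and "x \<in> weighted_L2 K w" and "pos_def_matrix U"
  shows "(LINT \<tau>:K|lebesgue_ereal. w \<tau> * (x \<tau> \<bullet> (U *v x \<tau>))) \<ge> \<theta> \<bullet> (kron FF U *v \<theta>)
    \<and> (\<forall>\<omega> :: real^('d \<times> 'n).
          2 * (\<theta> \<bullet> (kron (mat 1 :: real^'d^'d) U *v \<omega>)) - \<omega> \<bullet> (kron (matrix_inv FF) U *v \<omega>)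
            \<le> \<theta> \<bullet> (kron FF U *v \<theta>))
    \<and> (let \<omega> = kron FF (mat 1 :: real^'n^'n) *v \<theta> in
          2 * (\<theta> \<bullet> (kron (mat 1 :: real^'d^'d) U *v \<omega>)) - \<omega> \<bullet> (kron (matrix_inv FF) U *v \<omega>)
            = \<theta> \<bullet> (kron FF U *v \<theta>))"
proof -
  let ?N = "restrict_space lebesgue_ereal K"
  let ?R = "kron (mat 1 :: real^'d^'d) U"
  let ?Q = "kron FF (mat 1 :: real^'n^'n)"
  have meas: "w \<in> borel_measurable ?N" "f \<in> borel_measurable ?N" "x \<in> borel_measurable ?N"
    using assms(7,10,12) by (auto simp: weighted_L2_def)
  have w: "\<And>\<tau>. \<tau> \<in> space ?N \<Longrightarrow> 0 \<le> w \<tau>"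
    using assms(8) by (simp add: space_restrict_space)
  note f2 = weighted_L2_integrable[OF assms(5,7,8,10)]
  note x2 = weighted_L2_integrable[OF assms(5,7,8,12)]
  note restrict = set_lebesgue_integral_restrict_space[OF assms(5)]
  have bound: "2 * (\<theta> \<bullet> (?R *v \<omega>)) - \<omega> \<bullet> (kron G U *v \<omega>)
      \<le> (LINT \<tau>:K|lebesgue_ereal. w \<tau> * (x \<tau> \<bullet> (U *v x \<tau>)))" for \<omega>
    using weighted_energy_ge[OF meas w f2 x2 assms(13)]
    unfolding G_def \<theta>_def F_def restrict .
  \<comment> \<open>\<open>G \<otimes> U\<close> inherits semidefiniteness from the energy inequality for the zero function.\<close>
  have psd: "0 \<le> \<omega> \<bullet> (kron G U *v \<omega>)" for \<omega>
    using weighted_energy_ge[OF meas(1,2) _ w f2 _ assms(13), of "\<lambda>_. 0" \<omega>]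
    unfolding G_def restrict by simp
  have inv: "invertible G"
    using assms(11) by (rule invertible_pos_def_matrix)
  have FF: "matrix_inv FF = G" "G ** FF = mat 1"
    unfolding FF_def using inv by (simp_all add: matrix_inv_matrix_inv matrix_inv_inverse)
  have sym: "transpose G = G" "transpose U = U"
    using assms(11,13) by (simp_all add: pos_def_matrix_def)
  have square: "\<theta> \<bullet> (kron FF U *v \<theta>) - (2 * (\<theta> \<bullet> (?R *v \<omega>)) - \<omega> \<bullet> (kron G U *v \<omega>)) =
      (\<omega> - ?Q *v \<theta>) \<bullet> (kron G U *v (\<omega> - ?Q *v \<theta>))" for \<omega>
    using complete_square[of "kron G U" ?R ?Q \<theta> \<omega>]
    by (simp add: transpose_kron sym kron_mult_kron FF)
  have le: "2 * (\<theta> \<bullet> (?R *v \<omega>)) - \<omega> \<bullet> (kron G U *v \<omega>) \<le> \<theta> \<bullet> (kron FF U *v \<theta>)" for \<omega>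
    using square[of \<omega>] psd[of "\<omega> - ?Q *v \<theta>"] by linarith
  have eq: "2 * (\<theta> \<bullet> (?R *v (?Q *v \<theta>))) - (?Q *v \<theta>) \<bullet> (kron G U *v (?Q *v \<theta>)) = \<theta> \<bullet> (kron FF U *v \<theta>)"
    using square[of "?Q *v \<theta>"] by simp
  show ?thesis
    using bound[of "?Q *v \<theta>"] le eq by (simp add: FF Let_def)
qed

end
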